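(* Let $M_1=(E,r_1)$ and $M_2=(E,r_2)$ be two $q$-matroids on the same ground space $E$. Then the matroid union $M_1\vee M_2=(E,r)$, defined by $$r(A)=\min_{X\subseteq A}\{r_1(X)+r_2(X)+\dim A-\dim X\}\qquad (A\subseteq E),$$ is a $q$-matroid.
   Context: A $q$-matroid is a pair $(E,r)$, where $E$ is a finite-dimensional vector space over a field and $r$ is an integer-valued function on the set of subspaces of $E$ such that: (R1) $0\le r(A)\le\dim A$ for all $A$; (R2) $A\subseteq B$ implies $r(A)\le r(B)$; (R3) $r(A+B)+r(A\cap B)\le r(A)+r(B)$ for all $A,B$. In the definition of the matroid union, $X$ ranges over subspaces of $A$. *)

theory Defs
  imports HOL.Vector_Spaces "HOL-Library.Set_Algebras"
begin

text \<open>
  The ground space \<open>E\<close> is an arbitrary finite-dimensional subspace of an ambient vector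
  space whose own dimension is unrestricted. Only the values of \<open>r\<close> on subspaces of \<open>E\<close>
  matter.
\<close>

locale q_matroid = vector_space scale
  for scale :: "'a::field \<Rightarrow> 'b::ab_group_add \<Rightarrow> 'b" +
  fixes E :: "'b set" and r :: "'b set \<Rightarrow> int"
  assumes subspace_ground: "subspace E"
    and finite_dim_ground: "\<exists>B. finite B \<and> span B = E"
    and rank_bounds: "\<And>A. \<lbrakk>subspace A; A \<subseteq> E\<rbrakk> \<Longrightarrow> 0 \<le> r A \<and> r A \<le> int (dim A)"
    and rank_mono: "\<And>A B. \<lbrakk>subspace A; subspace B; B \<subseteq> E; A \<subseteq> B\<rbrakk> \<Longrightarrow> r A \<le> r B"
    and rank_submod: "\<And>A B. \<lbrakk>subspace A; A \<subseteq> E; subspace B; B \<subseteq> E\<rbrakk> \<Longrightarrow>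
      r (A + B) + r (A \<inter> B) \<le> r A + r B"

context vector_space
begin

text \<open>
  Over an infinite field, \<open>A\<close> may have infinitely many subspaces; for rank functions of
  \<open>q\<close>-matroids the set of values below is nevertheless finite, so that \<open>Min\<close> is its least
  element, see \<open>q_matroid_union_values\<close> and the two lemmas after it.
\<close>

definition q_matroid_union_rank ::
    "('b set \<Rightarrow> int) \<Rightarrow> ('b set \<Rightarrow> int) \<Rightarrow> 'b set \<Rightarrow> int" where
  "q_matroid_union_rank r1 r2 A =
    Min {r1 X + r2 X + int (dim A) - int (dim X) | X. subspace X \<and> X \<subseteq> A}"

end

lemma q_matroid_union_values:
  assumes "q_matroid scale E r1" "q_matroid scale E r2"
    and A: "module.subspace scale A" "A \<subseteq> E"
  defines "V \<equiv> {r1 X + r2 X + int (vector_space.dim scale A) - int (vector_space.dim scale X) | X.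
      module.subspace scale X \<and> X \<subseteq> A}"
  shows "finite V" and "V \<noteq> {}"
proof -
  interpret M1: q_matroid scale E r1 by fact
  interpret M2: q_matroid scale E r2 by fact
  obtain B where B: "finite B" "M1.span B = E"
    using M1.finite_dim_ground by blast
  have "V \<subseteq> {- int (card B) .. 3 * int (card B)}"
  proof
    fix v assume "v \<in> V"
    then obtain X where X: "M1.subspace X" "X \<subseteq> A"
      and v: "v = r1 X + r2 X + int (M1.dim A) - int (M1.dim X)"
      unfolding V_def by blast
    have "X \<subseteq> E" using X A by blast
    have "M1.dim A \<le> card B" "M1.dim X \<le> card B"
      using B A \<open>X \<subseteq> E\<close> by (auto intro!: M1.dim_le_card)
    then show "v \<in> {- int (card B) .. 3 * int (card B)}"
      using M1.rank_bounds[OF X(1) \<open>X \<subseteq> E\<close>] M2.rank_bounds[OF X(1) \<open>X \<subseteq> E\<close>] v by auto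
  qed
  then show "finite V" by (rule finite_subset) simp
  show "V \<noteq> {}" using A(1) unfolding V_def by blast
qed

lemma q_matroid_union_rank_le:
  assumes "q_matroid scale E r1" "q_matroid scale E r2"
    and "module.subspace scale A" "A \<subseteq> E" "module.subspace scale X" "X \<subseteq> A"
  shows "vector_space.q_matroid_union_rank scale r1 r2 A
    \<le> r1 X + r2 X + int (vector_space.dim scale A) - int (vector_space.dim scale X)"
proof -
  interpret q_matroid scale E r1 by fact
  show ?thesis
    unfolding q_matroid_union_rank_def
    by (rule Min_le) (use q_matroid_union_values[OF assms(1-4)] assms(5,6) in auto)
qed

lemma q_matroid_union_rank_attained:
  assumes "q_matroid scale E r1" "q_matroid scale E r2"
    and "module.subspace scale A" "A \<subseteq> E"
  obtains X where "module.subspace scale X" "X \<subseteq> A"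
    "vector_space.q_matroid_union_rank scale r1 r2 A
      = r1 X + r2 X + int (vector_space.dim scale A) - int (vector_space.dim scale X)"
proof -
  interpret q_matroid scale E r1 by fact
  show ?thesis
    using Min_in[OF q_matroid_union_values[OF assms]] that
    unfolding q_matroid_union_rank_def by blast
qed

end

theory Submission
  imports Defs
begin

text \<open>
  Write \<open>r\<close> for the rank function of the union and call a subspace \<open>X \<subseteq> A\<close> optimal for \<open>A\<close>
  if it attains the minimum that defines \<open>r A\<close>. Each axiom compares two ranks, or two sums of
  ranks, and is proved in the same way: take optimal subspaces on the side that should be large,
  combine them into candidates for the minimum on the side that should be small, and compare.

  For the bounds, the candidate \<open>{0}\<close> gives \<open>r A \<le> dim A\<close>. For monotonicity along
  \<open>A \<subseteq> B\<close>, an optimal \<open>X\<close> for \<open>B\<close> yields the candidate \<open>A \<inter> X\<close> for \<open>A\<close>: its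
  \<open>r1\<close> and \<open>r2\<close> are no larger, and the codimension of \<open>A \<inter> X\<close> in \<open>A\<close> equals that of
  \<open>X\<close> in \<open>A + X \<subseteq> B\<close>. For submodularity, optimal \<open>X\<close> for \<open>A\<close> and \<open>Y\<close> for \<open>B\<close>
  yield the candidates \<open>X + Y\<close> for \<open>A + B\<close> and \<open>X \<inter> Y\<close> for \<open>A \<inter> B\<close>: submodularity of
  \<open>r1\<close> and \<open>r2\<close> bounds the rank terms, while the dimension terms agree exactly because
  \<open>dim\<close> is modular. So the one fact from linear algebra behind the theorem is
  \<open>dim (S + T) + dim (S \<inter> T) = dim S + dim T\<close>, which is wanted for finite-dimensional subspaces
  of a space that may itself have infinite dimension.
\<close>

context vector_space
begin

lemma subspace_set_plus: "subspace S \<Longrightarrow> subspace T \<Longrightarrow> subspace (S + T)"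
proof -
  have "S + T = {x + y | x y. x \<in> S \<and> y \<in> T}"
    unfolding set_plus_def by blast
  then show "subspace S \<Longrightarrow> subspace T \<Longrightarrow> subspace (S + T)"
    using subspace_sums by simp
qed

lemma set_plus_subset_subspace:
  "subspace U \<Longrightarrow> S \<subseteq> U \<Longrightarrow> T \<subseteq> U \<Longrightarrow> S + T \<subseteq> U"
  by (auto elim!: set_plus_elim intro: subspace_add)

lemma span_Un_set_plus: "span (S \<union> T) = span S + span T"
  unfolding span_Un set_plus_def by blast

lemma subspace_finite_basis:
  assumes "subspace S" "S \<subseteq> span B" "finite B" "C \<subseteq> S" "independent C"
  obtains D where "C \<subseteq> D" "finite D" "independent D" "span D = S"
proof -
  obtain D where D: "C \<subseteq> D" "D \<subseteq> S" "independent D" "S \<subseteq> span D"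
    using maximal_independent_subset_extend[OF assms(4,5)] by blast
  have "finite D"
    using independent_span_bound[OF assms(3) D(3)] D(2) assms(2) by blast
  then show thesis
    using that D span_subspace assms(1) by blast
qed

text \<open>
  Bases of two subspaces that extend a common basis of the intersection have an independent
  union. The vectors of \<open>F - C\<close> can be added to \<open>D\<close> one by one: if a new vector \<open>f\<close> were
  \<open>s + t\<close> with \<open>s\<close> in the span of \<open>D\<close> and \<open>t\<close> in the span of the earlier vectors of
  \<open>F\<close>, then \<open>s = f - t\<close> would lie in the intersection, hence in the span of \<open>C\<close>, and \<open>f\<close>
  would depend on other vectors of \<open>F\<close>.
\<close>

lemma independent_Un_extending_basis_Int:
  assumes D: "independent D"
    and F: "independent F" "finite F" "C \<subseteq> F"
    and int: "span D \<inter> span F \<subseteq> span C"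
  shows "independent (D \<union> (F - C))"
proof -
  have "independent (D \<union> G)" if "finite G" "G \<subseteq> F - C" for G
    using that
  proof (induction G rule: finite_induct)
    case empty
    then show ?case using D by simp
  next
    case (insert f G)
    have "f \<notin> span (D \<union> G)"
    proof
      assume "f \<in> span (D \<union> G)"
      then obtain s t where st: "f = s + t" "s \<in> span D" "t \<in> span G"
        unfolding span_Un by blast
      have "t \<in> span F"
        using st(3) span_mono[of G F] insert.prems by blast
      moreover have "f \<in> span F"
        using insert.prems by (auto intro: span_base)
      ultimately have "s \<in> span F"
        using span_diff[of f F t] st(1) by simp
      then have "s \<in> span C" using int st(2) by blast
      then have "f \<in> span (C \<union> G)"
        unfolding span_Un using st by blast
      moreover have "C \<union> G \<subseteq> F - {f}"
        using insert.prems insert.hyps(2) F(3) by blast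
      ultimately have "f \<in> span (F - {f})"
        using span_mono by blast
      then show False
        using F(1) insert.prems unfolding dependent_def by blast
    qed
    then show ?case
      using insert.IH insert.prems by (simp add: independent_insertI)
  qed
  then show ?thesis using F(2) by simp
qed

text \<open>
  Only the subspaces are finite-dimensional here, not the ambient space, so finiteness of the
  bases is drawn from a finite set \<open>B\<close> whose span contains both subspaces.
\<close>

lemma dim_set_plus_Int:
  assumes S: "subspace S" "S \<subseteq> span B" and T: "subspace T" "T \<subseteq> span B" and B: "finite B"
  shows "dim (S + T) + dim (S \<inter> T) = dim S + dim T"
proof -
  obtain C where C: "finite C" "independent C" "span C = S \<inter> T"
    using subspace_finite_basis[of "S \<inter> T" B "{}"] S T B
    by (auto simp: subspace_inter independent_empty)
  have CST: "C \<subseteq> S" "C \<subseteq> T"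
    using span_superset[of C] C(3) by auto
  obtain D where D: "C \<subseteq> D" "finite D" "independent D" "span D = S"
    using subspace_finite_basis[OF S B CST(1) C(2)] by blast
  obtain F where F: "C \<subseteq> F" "finite F" "independent F" "span F = T"
    using subspace_finite_basis[OF T B CST(2) C(2)] by blast
  have indep: "independent (D \<union> (F - C))"
    by (rule independent_Un_extending_basis_Int) (use C D F in auto)
  have "span (D \<union> (F - C)) = span (D \<union> F)"
    using D(1) by (intro arg_cong[of _ _ span]) blast
  also have "\<dots> = S + T"
    using D F by (simp add: span_Un_set_plus)
  finally have "dim (S + T) = card (D \<union> (F - C))"
    using indep by (metis dim_span_eq_card_independent)
  \<comment> \<open>A vector of \<open>D \<inter> F\<close> outside \<open>C\<close> would lie in the span of \<open>C\<close>, making \<open>F\<close> dependent.\<close>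
  moreover have "D \<inter> (F - C) = {}"
  proof (rule ccontr)
    assume "D \<inter> (F - C) \<noteq> {}"
    then obtain x where x: "x \<in> D" "x \<in> F" "x \<notin> C" by blast
    have "x \<in> span C"
      using x C D F span_base by blast
    then have "x \<in> span (F - {x})"
      using span_mono[of C "F - {x}"] F(1) x(3) by blast
    then show False
      using F(3) x(2) unfolding dependent_def by blast
  qed
  ultimately have "dim (S + T) = card D + (card F - card C)"
    using D F C by (simp add: card_Un_disjoint card_Diff_subset)
  moreover have "card C \<le> card F"
    using F by (intro card_mono)
  moreover have "dim S = card D" "dim T = card F" "dim (S \<inter> T) = card C"
    using C D F dim_span_eq_card_independent by metis+
  ultimately show ?thesis by simp
qed

lemma dim_mono_finite_span:
  assumes "subspace T" "S \<subseteq> T" "T \<subseteq> span B" "finite B"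
  shows "dim S \<le> dim T"
proof -
  obtain D where D: "finite D" "independent D" "span D = T"
    using subspace_finite_basis[OF assms(1,3,4), of "{}"] by (auto simp: independent_empty)
  show ?thesis
    using dim_le_card[of S D] dim_span_eq_card_independent[of D] D assms(2) by simp
qed

end

context q_matroid
begin

lemma dim_modular:
  assumes "subspace S" "S \<subseteq> E" "subspace T" "T \<subseteq> E"
  shows "dim (S + T) + dim (S \<inter> T) = dim S + dim T"
  using finite_dim_ground dim_set_plus_Int assms by blast

lemma dim_mono_ground: "subspace T \<Longrightarrow> S \<subseteq> T \<Longrightarrow> T \<subseteq> E \<Longrightarrow> dim S \<le> dim T"
  using finite_dim_ground dim_mono_finite_span by blast

lemma rank_zero: "r {0} = 0"
proof -
  have "dim {0} = 0"
    using dim_le_card[of "{0}" "{}"] by simp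
  then show ?thesis
    using rank_bounds[of "{0}"] subspace_0[OF subspace_ground] by simp
qed

end

theorem theorem29:
  fixes scale :: "'a::field \<Rightarrow> 'b::ab_group_add \<Rightarrow> 'b"
    and E :: "'b set" and r1 r2 :: "'b set \<Rightarrow> int"
  assumes "q_matroid scale E r1" and "q_matroid scale E r2"
  shows "q_matroid scale E (vector_space.q_matroid_union_rank scale r1 r2)"
proof -
  interpret M1: q_matroid scale E r1 by fact
  interpret M2: q_matroid scale E r2 by fact
  let ?r = "M1.q_matroid_union_rank r1 r2"
  note le = q_matroid_union_rank_le[OF assms]
  note attained = q_matroid_union_rank_attained[OF assms]
  show ?thesis
  proof unfold_locales
    show "M1.subspace E" by (rule M1.subspace_ground)
    show "\<exists>B. finite B \<and> M1.span B = E" by (rule M1.finite_dim_ground)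
  next
    fix A assume A: "M1.subspace A" "A \<subseteq> E"
    obtain X where X: "M1.subspace X" "X \<subseteq> A"
      "?r A = r1 X + r2 X + int (M1.dim A) - int (M1.dim X)"
      using attained[OF A] by blast
    have "M1.dim X \<le> M1.dim A"
      using M1.dim_mono_ground A X by blast
    then have "0 \<le> ?r A"
      using X A M1.rank_bounds[of X] M2.rank_bounds[of X] by fastforce
    moreover have "?r A \<le> int (M1.dim A)"
      using le[OF A, of "{0}"] M1.subspace_0[OF A(1)] M1.rank_zero M2.rank_zero by simp
    ultimately show "0 \<le> ?r A \<and> ?r A \<le> int (M1.dim A)" by simp
  next
    fix A B assume A: "M1.subspace A" and B: "M1.subspace B" "B \<subseteq> E" and AB: "A \<subseteq> B"
    obtain X where X: "M1.subspace X" "X \<subseteq> B"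
      "?r B = r1 X + r2 X + int (M1.dim B) - int (M1.dim X)"
      using attained[OF B] by blast
    have AE: "A \<subseteq> E" and XE: "X \<subseteq> E" using AB X B by auto
    have AX: "M1.subspace (A \<inter> X)"
      using A X by (simp add: M1.subspace_inter)
    have "M1.dim (A + X) \<le> M1.dim B"
      using M1.dim_mono_ground B M1.set_plus_subset_subspace[OF B(1) AB X(2)] by blast
    then have "int (M1.dim A) - int (M1.dim (A \<inter> X)) \<le> int (M1.dim B) - int (M1.dim X)"
      using M1.dim_modular[OF A AE X(1) XE] by linarith
    moreover have "r1 (A \<inter> X) \<le> r1 X" "r2 (A \<inter> X) \<le> r2 X"
      using M1.rank_mono[OF AX X(1) XE] M2.rank_mono[OF AX X(1) XE] by auto
    moreover have "?r A \<le> r1 (A \<inter> X) + r2 (A \<inter> X) + int (M1.dim A) - int (M1.dim (A \<inter> X))"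
      using le[OF A AE AX] by simp
    ultimately show "?r A \<le> ?r B" using X(3) by linarith
  next
    fix A B assume A: "M1.subspace A" "A \<subseteq> E" and B: "M1.subspace B" "B \<subseteq> E"
    obtain X where X: "M1.subspace X" "X \<subseteq> A"
      "?r A = r1 X + r2 X + int (M1.dim A) - int (M1.dim X)"
      using attained[OF A] by blast
    obtain Y where Y: "M1.subspace Y" "Y \<subseteq> B"
      "?r B = r1 Y + r2 Y + int (M1.dim B) - int (M1.dim Y)"
      using attained[OF B] by blast
    have XE: "X \<subseteq> E" and YE: "Y \<subseteq> E" using X Y A B by auto
    have "?r (A + B)
        \<le> r1 (X + Y) + r2 (X + Y) + int (M1.dim (A + B)) - int (M1.dim (X + Y))"
      using A B X Y M1.subspace_ground
      by (intro le M1.subspace_set_plus M1.set_plus_subset_subspace set_plus_mono2)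
    moreover have "?r (A \<inter> B)
        \<le> r1 (X \<inter> Y) + r2 (X \<inter> Y) + int (M1.dim (A \<inter> B)) - int (M1.dim (X \<inter> Y))"
      using A B X Y by (intro le M1.subspace_inter) auto
    moreover note
      M1.dim_modular[OF A B] M1.dim_modular[OF X(1) XE Y(1) YE]
      M1.rank_submod[OF X(1) XE Y(1) YE] M2.rank_submod[OF X(1) XE Y(1) YE]
    ultimately show "?r (A + B) + ?r (A \<inter> B) \<le> ?r A + ?r B"
      using X(3) Y(3) by linarith
  qed
qed

end
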